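(* Let $C\subseteq\mathbb{Z}_2^n$ be a subset of size $10$ and dimension $7$. Then $C$ is a cap if and only if $C$ has a basis of extended type $5\text{-}5\text{-}(2)$ or $5\text{-}5\text{-}(3)$.
   Context: Work in $\mathbb{Z}_2^n$. An affine combination of a set is a sum of an odd number of its distinct elements; $\operatorname{aff}(S)$ is the set of all affine combinations of elements of $S$, and the dimension of $S$ is the dimension of the affine flat $\operatorname{aff}(S)$. A basis for $S$ is a subset $B\subseteq S$ that is affinely independent (no element is an affine combination of the others) with $\operatorname{aff}(B)=\operatorname{aff}(S)$; its dependent set is $D=S\setminus B$. For $x\in D$, $B_x$ is the unique subset of $B$ whose elements sum to $x$. A quad is a set of four distinct elements summing to $\mathbf{0}$; a cap is a quad-free subset. For $D=\{x_1,x_2\}$, a basis $B$ has extended type $n_1\text{-}n_2\text{-}(m)$ if the elements of $D$ can be labeled $x_1,x_2$ so that $|B_{x_1}|=n_1$, $|B_{x_2}|=n_2$ and $|B_{x_1}\cap B_{x_2}|=m$. *)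

theory Defs
  imports "HOL-Analysis.Cartesian_Space" "HOL-Library.Z2"
begin

type_synonym 'n Z2vec = "(bit, 'n) vec"

definition aff :: "('n::finite) Z2vec set \<Rightarrow> 'n Z2vec set" where
  "aff S = {\<Sum>T | T. T \<subseteq> S \<and> finite T \<and> odd (card T)}"

text \<open>The dimension of a flat is the linear dimension of its direction space.\<close>

definition direction :: "('n::finite) Z2vec set \<Rightarrow> 'n Z2vec set" where
  "direction F = {x - y | x y. x \<in> F \<and> y \<in> F}"

definition aff_dimension :: "('n::finite) Z2vec set \<Rightarrow> nat" where
  "aff_dimension S = vec.dim (direction (aff S))"

definition aff_independent :: "('n::finite) Z2vec set \<Rightarrow> bool" where
  "aff_independent B \<longleftrightarrow> (\<forall>x\<in>B. x \<notin> aff (B - {x}))"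

definition is_aff_basis :: "('n::finite) Z2vec set \<Rightarrow> 'n Z2vec set \<Rightarrow> bool" where
  "is_aff_basis B S \<longleftrightarrow> B \<subseteq> S \<and> aff_independent B \<and> aff B = aff S"

text \<open>
  The subset \<open>B\<^sub>x\<close> expresses \<open>x\<close> as an affine combination of \<open>B\<close>, hence has odd cardinality.
  The parity requirement is essential for uniqueness: an affinely independent set may be
  linearly dependent (for instance if it contains \<open>0\<close>), and then \<open>x\<close> is also the sum of a subset
  of \<open>B\<close> of even cardinality.
\<close>

definition basis_rep :: "('n::finite) Z2vec set \<Rightarrow> 'n Z2vec \<Rightarrow> 'n Z2vec set" where
  "basis_rep B x = (THE T. T \<subseteq> B \<and> finite T \<and> odd (card T) \<and> \<Sum>T = x)"

definition is_quad :: "('n::finite) Z2vec set \<Rightarrow> bool" where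
  "is_quad Q \<longleftrightarrow> card Q = 4 \<and> \<Sum>Q = 0"

definition is_cap :: "('n::finite) Z2vec set \<Rightarrow> bool" where
  "is_cap C \<longleftrightarrow> \<not> (\<exists>Q. Q \<subseteq> C \<and> is_quad Q)"

definition has_extended_type ::
  "('n::finite) Z2vec set \<Rightarrow> 'n Z2vec set \<Rightarrow> nat \<Rightarrow> nat \<Rightarrow> nat \<Rightarrow> bool" where
  "has_extended_type S B n1 n2 m \<longleftrightarrow>
     (\<exists>x1 x2. x1 \<noteq> x2 \<and> S - B = {x1, x2} \<and>
        card (basis_rep B x1) = n1 \<and> card (basis_rep B x2) = n2 \<and>
        card (basis_rep B x1 \<inter> basis_rep B x2) = m)"

lemma Z2vec_add_self: "x + x = 0" for x :: "('n::finite) Z2vec"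
  by (simp add: vec_eq_iff)

lemma sum_sym_diff:
  fixes A B :: "('n::finite) Z2vec set"
  assumes "finite A" "finite B"
  shows "\<Sum>((A - B) \<union> (B - A)) = \<Sum>A + \<Sum>B"
proof -
  have "\<Sum>A = \<Sum>(A - B) + \<Sum>(A \<inter> B)"
    using assms by (metis Diff_Diff_Int Diff_subset add.commute sum.subset_diff)
  moreover have "\<Sum>B = \<Sum>(B - A) + \<Sum>(A \<inter> B)"
    using assms by (metis Diff_Diff_Int Diff_subset Int_commute add.commute sum.subset_diff)
  moreover have "\<Sum>((A - B) \<union> (B - A)) = \<Sum>(A - B) + \<Sum>(B - A)"
    using assms by (intro sum.union_disjoint) auto
  moreover have "(a + c) + (b + c) = a + b + (c + c)" for a b c :: "'n Z2vec"
    by (simp add: algebra_simps)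
  ultimately show ?thesis
    by (simp add: Z2vec_add_self)
qed

lemma basis_rep_ex1:
  assumes "aff_independent B" "x \<in> aff B"
  shows "\<exists>!T. T \<subseteq> B \<and> finite T \<and> odd (card T) \<and> \<Sum>T = x"
proof (rule ex_ex1I)
  show "\<exists>T. T \<subseteq> B \<and> finite T \<and> odd (card T) \<and> \<Sum>T = x"
    using assms(2) unfolding aff_def by auto
next
  fix T T'
  assume T: "T \<subseteq> B \<and> finite T \<and> odd (card T) \<and> \<Sum>T = x"
    and T': "T' \<subseteq> B \<and> finite T' \<and> odd (card T') \<and> \<Sum>T' = x"
  show "T = T'"
  proof (rule ccontr)
    assume "T \<noteq> T'"
    define U where "U = (T - T') \<union> (T' - T)"
    have fin: "finite U" and sub: "U \<subseteq> B" using T T' by (auto simp: U_def)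
    have sumU: "\<Sum>U = 0"
      using T T' sum_sym_diff[of T T'] by (simp add: U_def Z2vec_add_self)
    have "card T = card (T - T') + card (T \<inter> T')" "card T' = card (T' - T) + card (T \<inter> T')"
      using T T' by (metis card_Diff_subset_Int card_mono inf_le1 finite_Int le_add_diff_inverse2,
        metis card_Diff_subset_Int card_mono inf_le2 finite_Int le_add_diff_inverse2 inf_commute)
    moreover have "card U = card (T - T') + card (T' - T)"
      unfolding U_def using T T' by (intro card_Un_disjoint) auto
    ultimately have even: "even (card U)" using T T' by (metis even_add)
    obtain b where b: "b \<in> U" using \<open>T \<noteq> T'\<close> by (auto simp: U_def)
    have "b + \<Sum>(U - {b}) = 0"
      using sum.remove[OF fin b, of "\<lambda>x. x"] sumU by simp
    then have "b = \<Sum>(U - {b})"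
      by (metis Z2vec_add_self add_left_cancel)
    moreover have "odd (card (U - {b}))"
      using even fin b card_gt_0_iff[of U] by (auto simp: card_Diff_singleton)
    ultimately have "b \<in> aff (B - {b})"
      unfolding aff_def using sub fin by (intro CollectI exI[of _ "U - {b}"]) auto
    then show False
      using assms(1) b sub unfolding aff_independent_def by blast
  qed
qed

end

theory Submission
  imports Defs
begin

text \<open>
  The subsets of \<open>C\<close> of even cardinality and sum zero are closed under symmetric difference.
  Since a basis of \<open>C\<close> has 8 elements, leaving two dependent ones, there are exactly four such sets
  \<open>\<emptyset>, P, Q, P \<triangle> Q\<close>. The cardinalities of the last three sum to
  \<open>2 \<bar>P \<union> Q\<bar> \<le> 20\<close>; in a cap each is at least 6, so they are 6, 6, 6 or 6, 6, 8. Removing from \<open>C\<close>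
  one point of \<open>P - Q\<close> and one of \<open>Q - P\<close>, where \<open>P\<close> and \<open>Q\<close> have size 6, leaves a basis of
  the required type.
\<close>

section \<open>Even zero-sum sets and affine independence\<close>

definition even_relation :: "('n::finite) Z2vec set \<Rightarrow> bool" where
  "even_relation U \<longleftrightarrow> even (card U) \<and> \<Sum>U = 0"

text \<open>A vector over Z_2 is determined by its support, so the vectors inject into the subsets
  of a finite index type. As a simp rule this discharges the finiteness conditions in
  \<open>aff\<close> and in the sum lemmas.\<close>

lemma finite_Z2vec_set [simp]: "finite (S :: ('n::finite) Z2vec set)"
proof -
  have "inj (\<lambda>x :: 'n Z2vec. {i. x $ i = 1})"
  proof (rule injI)
    fix x y :: "'n Z2vec" assume "{i. x $ i = 1} = {i. y $ i = 1}"
    then have "x $ i = 1 \<longleftrightarrow> y $ i = 1" for i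
      by blast
    then have "x $ i = y $ i" for i
      by (cases "x $ i"; cases "y $ i") (metis zero_neq_one)+
    then show "x = y"
      by (simp add: vec_eq_iff)
  qed
  then have "finite (UNIV :: 'n Z2vec set)"
    by (rule finite_imageD[rotated]) simp
  then show ?thesis
    using finite_subset subset_UNIV by blast
qed

lemma Z2vec_add_eq_0_iff: "x + y = 0 \<longleftrightarrow> x = y" for x y :: "('n::finite) Z2vec"
  by (metis Z2vec_add_self add_left_cancel)

lemma Z2vec_diff_eq_add: "x - y = x + y" for x y :: "('n::finite) Z2vec"
  by (simp add: diff_eq_eq add.assoc Z2vec_add_self)

lemma card_sym_diff:
  assumes "finite A" "finite B"
  shows "card (sym_diff A B) + 2 * card (A \<inter> B) = card A + card B"
proof -
  have "card A = card (A - B) + card (A \<inter> B)"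
    using assms by (metis Int_Diff_Un Int_Diff_disjoint card_Un_disjoint finite_Diff finite_Int add.commute)
  moreover have "card B = card (B - A) + card (A \<inter> B)"
    using assms by (metis Int_Diff_Un Int_Diff_disjoint card_Un_disjoint finite_Diff finite_Int add.commute Int_commute)
  moreover have "card (sym_diff A B) = card (A - B) + card (B - A)"
    using assms by (intro card_Un_disjoint) auto
  ultimately show ?thesis by simp
qed

lemma even_card_sym_diff_iff:
  assumes "finite A" "finite B"
  shows "even (card (sym_diff A B)) \<longleftrightarrow> (even (card A) \<longleftrightarrow> even (card B))"
proof -
  have "even (card (sym_diff A B) + 2 * card (A \<inter> B)) \<longleftrightarrow> even (card A + card B)"
    using card_sym_diff[OF assms] by simp
  then show ?thesis by simp
qed

lemma even_relation_sym_diff: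
  "even_relation A \<Longrightarrow> even_relation B \<Longrightarrow> even_relation (sym_diff A B)"
  by (simp add: even_relation_def even_card_sym_diff_iff sum_sym_diff)

lemma even_relation_remove:
  assumes "even_relation U" "x \<in> U"
  shows "odd (card (U - {x}))" "\<Sum>(U - {x}) = x"
proof -
  show "odd (card (U - {x}))"
    using assms card_gt_0_iff[of U] by (auto simp: even_relation_def card_Diff_singleton)
  have "x + \<Sum>(U - {x}) = 0"
    using assms sum.remove[of U x "\<lambda>x. x"] by (simp add: even_relation_def)
  then show "\<Sum>(U - {x}) = x"
    by (simp add: Z2vec_add_eq_0_iff)
qed

lemma even_relation_insert:
  assumes "odd (card T)" "\<Sum>T = x" "x \<notin> T"
  shows "even_relation (insert x T)"
  using assms by (simp add: even_relation_def Z2vec_add_self)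

text \<open>Size 2 is impossible because x + y = 0 forces x = y. So quads are the smallest nonempty
  even relations that can occur.\<close>

lemma even_relation_card_ge_4:
  assumes "even_relation U" "U \<noteq> {}"
  shows "card U \<ge> 4"
proof (rule ccontr)
  assume "\<not> card U \<ge> 4"
  moreover have "card U \<noteq> 0" "even (card U)"
    using assms by (auto simp: even_relation_def)
  ultimately have "card U = 2"
    by presburger
  then obtain x y where "U = {x, y}" "x \<noteq> y"
    by (auto simp: card_2_iff)
  with assms show False
    by (simp add: even_relation_def Z2vec_add_eq_0_iff)
qed

text \<open>In characteristic 2 a point can be moved across an equation: x is the sum of an odd set
  T not containing x exactly when \<open>insert x T\<close> is an even relation. Even relations are
  thus the supports of affine dependences, with even cardinality saying that the coefficients sum to
  zero.\<close>

lemma aff_independent_iff: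
  "aff_independent B \<longleftrightarrow> (\<forall>U \<subseteq> B. even_relation U \<longrightarrow> U = {})"
proof (intro iffI allI impI)
  fix U assume B: "aff_independent B" and U: "U \<subseteq> B" "even_relation U"
  show "U = {}"
  proof (rule ccontr)
    assume "U \<noteq> {}"
    then obtain b where b: "b \<in> U" by blast
    have "b \<in> aff (B - {b})"
      unfolding aff_def using even_relation_remove[OF U(2) b] U
      by (intro CollectI exI[of _ "U - {b}"]) auto
    then show False
      using B b U unfolding aff_independent_def by blast
  qed
next
  assume *: "\<forall>U \<subseteq> B. even_relation U \<longrightarrow> U = {}"
  show "aff_independent B"
    unfolding aff_independent_def
  proof (intro ballI notI)
    fix x assume x: "x \<in> B" "x \<in> aff (B - {x})"
    then obtain T where T: "T \<subseteq> B - {x}" "odd (card T)" "\<Sum>T = x"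
      unfolding aff_def by auto
    then have "even_relation (insert x T)"
      by (intro even_relation_insert) auto
    then show False
      using * T x by blast
  qed
qed

section \<open>Affine hulls and existence of bases\<close>

lemma subset_aff: "S \<subseteq> aff S"
proof
  fix x assume "x \<in> S"
  then show "x \<in> aff S"
    unfolding aff_def by (intro CollectI exI[of _ "{x}"]) auto
qed

lemma aff_mono: "S \<subseteq> T \<Longrightarrow> aff S \<subseteq> aff T"
  unfolding aff_def by blast

text \<open>Each point of T is replaced by an odd subset of B that sums to it. Symmetric difference
  adds both sums and parities of cardinalities, so repeated points cancel correctly. This gives the
  idempotence of \<open>aff\<close> behind \<open>aff_eqI\<close>.\<close>

lemma sum_affine_combinations:
  assumes "finite T" "T \<subseteq> aff B"
  shows "\<exists>U \<subseteq> B. \<Sum>U = \<Sum>T \<and> (even (card U) \<longleftrightarrow> even (card T))"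
  using assms
proof (induction T rule: finite_induct)
  case empty
  then show ?case by (intro exI[of _ "{}"]) auto
next
  case (insert x T)
  then obtain U where U: "U \<subseteq> B" "\<Sum>U = \<Sum>T" "even (card U) \<longleftrightarrow> even (card T)"
    by auto
  obtain V where V: "V \<subseteq> B" "\<Sum>V = x" "odd (card V)"
    using insert.prems unfolding aff_def by auto
  show ?case
    using U V insert.hyps
    by (intro exI[of _ "sym_diff V U"])
       (auto simp: sum_sym_diff even_card_sym_diff_iff)
qed

lemma aff_eqI:
  assumes "B \<subseteq> S" "S \<subseteq> aff B"
  shows "aff B = aff S"
proof
  show "aff B \<subseteq> aff S"
    using assms(1) by (rule aff_mono)
  show "aff S \<subseteq> aff B"
  proof
    fix x assume "x \<in> aff S"
    then obtain T where T: "T \<subseteq> S" "odd (card T)" "\<Sum>T = x"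
      unfolding aff_def by auto
    then obtain U where "U \<subseteq> B" "\<Sum>U = x" "odd (card U)"
      using sum_affine_combinations[of T B] assms(2) by auto
    then show "x \<in> aff B"
      unfolding aff_def by auto
  qed
qed

text \<open>A maximal independent subset works: adding a further point x creates a nonempty
  relation, which must contain x and can be solved for it.\<close>

lemma aff_basis_exists: "\<exists>B. is_aff_basis B S"
proof -
  let ?I = "\<lambda>B. B \<subseteq> S \<and> aff_independent B"
  have "?I {}"
    by (simp add: aff_independent_def)
  moreover have "finite {B. ?I B}"
    by (rule finite_subset[of _ "Pow S"]) auto
  ultimately have "\<exists>B\<in>{B. ?I B}. \<forall>B'\<in>{B. ?I B}. B \<subseteq> B' \<longrightarrow> B = B'"
    by (intro finite_has_maximal) auto
  then obtain B where B: "?I B" and max: "\<And>B'. ?I B' \<Longrightarrow> B \<subseteq> B' \<Longrightarrow> B = B'"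
    by auto
  have "S \<subseteq> aff B"
  proof
    fix x assume x: "x \<in> S"
    show "x \<in> aff B"
    proof (cases "x \<in> B")
      case True
      then show ?thesis using subset_aff by blast
    next
      case False
      then have "\<not> aff_independent (insert x B)"
        using max[of "insert x B"] B x by auto
      then obtain U where U: "U \<subseteq> insert x B" "even_relation U" "U \<noteq> {}"
        unfolding aff_independent_iff by blast
      then have "x \<in> U"
        using B unfolding aff_independent_iff by blast
      then show ?thesis
        using even_relation_remove[OF U(2)] U(1) unfolding aff_def
        by (intro CollectI exI[of _ "U - {x}"]) auto
    qed
  qed
  with B show ?thesis
    unfolding is_aff_basis_def using aff_eqI by blast
qed

section \<open>Size of a basis and dimension\<close>

lemma sum_translate:
  fixes c :: "('n::finite) Z2vec"
  shows "(\<Sum>t\<in>T. t + c) = \<Sum>T + (if odd (card T) then c else 0)"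
proof -
  have "finite T \<Longrightarrow> (\<Sum>t\<in>T. t + c) = \<Sum>T + (if odd (card T) then c else 0)" for T
    by (induction T rule: finite_induct) (auto simp: algebra_simps Z2vec_add_self)
  then show ?thesis by simp
qed

text \<open>Translating by a base point c turns affine into linear independence. A vanishing sum
  over t in T of t + c contains c with multiplicity \<open>card T\<close>, so T itself is an even
  relation in B if \<open>card T\<close> is even, and \<open>insert c T\<close> is one
  otherwise.\<close>

lemma independent_translate:
  assumes B: "aff_independent B" "c \<in> B"
  shows "vec.independent ((\<lambda>b. b + c) ` (B - {c}))" (is "vec.independent ?X")
proof
  assume "vec.dependent ?X"
  then obtain u v where u: "(\<Sum>v\<in>?X. u v *s v) = 0" and v: "v \<in> ?X" "u v \<noteq> 0"
    unfolding vec.dependent_finite[OF finite_Z2vec_set] by blast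
  \<comment> \<open>Coefficients are 0 or 1, so the linear combination is just a sum over its
    support.\<close>
  define T where "T = {t \<in> B - {c}. u (t + c) = 1}"
  have "(\<Sum>v\<in>?X. u v *s v) = (\<Sum>t\<in>B - {c}. u (t + c) *s (t + c))"
    by (subst sum.reindex) (auto simp: inj_on_def)
  also have "\<dots> = (\<Sum>t\<in>T. t + c)"
    unfolding T_def
    by (rule sum.mono_neutral_cong_right) auto
  finally have sum: "\<Sum>T + (if odd (card T) then c else 0) = 0"
    using u by (simp add: sum_translate)
  have T: "T \<noteq> {}" "T \<subseteq> B - {c}"
    using v by (auto simp: T_def)
  show False
  proof (cases "even (card T)")
    case True
    then have "even_relation T"
      using sum by (simp add: even_relation_def)
    then show False
      using T B(1) unfolding aff_independent_iff by blast
  next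
    case False
    then have "\<Sum>T = c"
      using sum by (simp add: Z2vec_add_eq_0_iff)
    then have "even_relation (insert c T)"
      using False T by (intro even_relation_insert) auto
    then show False
      using T B unfolding aff_independent_iff by blast
  qed
qed

text \<open>The differences from a base point c form a linear basis of the direction space, and c
  itself accounts for the additional 1. The empty set has an empty basis but also dimension 0, hence
  the nonemptiness assumption.\<close>

lemma aff_dimension_eq_card_basis:
  assumes B: "is_aff_basis B S" and S: "S \<noteq> {}"
  shows "card B = aff_dimension S + 1"
proof -
  have ind: "aff_independent B" and aff: "aff S = aff B"
    using B by (auto simp: is_aff_basis_def)
  have "B \<noteq> {}"
    using S aff subset_aff[of S] by (auto simp: aff_def)
  then obtain c where c: "c \<in> B" by blast
  let ?X = "(\<lambda>b. b + c) ` (B - {c})"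
  have "?X \<subseteq> direction (aff B)"
    using subset_aff[of B] c by (auto simp: direction_def Z2vec_diff_eq_add)
  moreover have "direction (aff B) \<subseteq> vec.span ?X"
  proof -
    have *: "x + c \<in> vec.span ?X" if x: "x \<in> aff B" for x
    proof -
      obtain T where T: "T \<subseteq> B" "odd (card T)" "\<Sum>T = x"
        using x unfolding aff_def by auto
      have "(\<Sum>t\<in>T. t + c) \<in> vec.span ?X"
      proof (rule vec.span_sum)
        fix t assume "t \<in> T"
        then show "t + c \<in> vec.span ?X"
          using T(1) by (cases "t = c") (auto simp: Z2vec_add_self vec.span_zero intro: vec.span_base)
      qed
      then show ?thesis
        using T by (simp add: sum_translate)
    qed
    \<comment> \<open>The base point cancels: x - y = (x + c) - (y + c).\<close>
    have "x - y \<in> vec.span ?X" if "x \<in> aff B" "y \<in> aff B" for x y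
      using vec.span_diff[OF *[OF that(1)] *[OF that(2)]] by simp
    then show ?thesis
      by (auto simp: direction_def)
  qed
  ultimately have "card ?X = vec.dim (direction (aff B))"
    using independent_translate[OF ind c] by (rule vec.basis_card_eq_dim)
  moreover have "card ?X = card B - 1"
    using c by (subst card_image) (auto simp: inj_on_def)
  moreover have "card B > 0"
    using c by (auto simp: card_gt_0_iff)
  ultimately show ?thesis
    by (simp add: aff_dimension_def aff)
qed

section \<open>Basis representations and the relations of a set with two dependent points\<close>

lemma basis_rep_props:
  assumes "aff_independent B" "x \<in> aff B"
  shows "basis_rep B x \<subseteq> B" "odd (card (basis_rep B x))" "\<Sum>(basis_rep B x) = x"
  using theI'[OF basis_rep_ex1[OF assms]] unfolding basis_rep_def by auto

lemma basis_rep_eqI: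
  assumes "aff_independent B" "T \<subseteq> B" "odd (card T)" "\<Sum>T = x"
  shows "basis_rep B x = T"
proof -
  have "x \<in> aff B"
    using assms unfolding aff_def by auto
  then show ?thesis
    unfolding basis_rep_def using assms
    by (intro the1_equality basis_rep_ex1) auto
qed

lemma even_relation_basis_rep:
  assumes "aff_independent B" "x \<in> aff B" "x \<notin> B"
  shows "even_relation (insert x (basis_rep B x))"
  using assms basis_rep_props[OF assms(1,2)] by (intro even_relation_insert) auto

text \<open>An even relation in C is determined by which of x, y it contains: two relations that
  agree there differ by an even relation inside B, which is empty. The four listed sets realize all
  four possibilities.\<close>

lemma even_relations_codimension_2:
  assumes B: "aff_independent B" "C - B = {x, y}"
    and P: "P \<subseteq> C" "even_relation P" "x \<in> P" "y \<notin> P"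
    and Q: "Q \<subseteq> C" "even_relation Q" "y \<in> Q" "x \<notin> Q"
    and U: "U \<subseteq> C" "even_relation U"
  shows "U \<in> {{}, P, Q, sym_diff P Q}"
proof -
  have eq: "U = V" if V: "V \<subseteq> C" "even_relation V" "x \<in> U \<longleftrightarrow> x \<in> V" "y \<in> U \<longleftrightarrow> y \<in> V" for V
  proof -
    have "sym_diff U V \<subseteq> B"
    proof
      fix z assume z: "z \<in> sym_diff U V"
      then have "z \<in> C" "z \<noteq> x" "z \<noteq> y"
        using V U(1) by auto
      then show "z \<in> B"
        using B(2) by auto
    qed
    then have "sym_diff U V = {}"
      using B(1) even_relation_sym_diff[OF U(2) V(2)] unfolding aff_independent_iff by metis
    then show ?thesis by auto
  qed
  have R: "sym_diff P Q \<subseteq> C" "even_relation (sym_diff P Q)"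
    using P Q even_relation_sym_diff by auto
  have E: "{} \<subseteq> C" "even_relation {}"
    by (simp_all add: even_relation_def)
  show ?thesis
    using eq[OF E] eq[OF P(1,2)] eq[OF Q(1,2)] eq[OF R] P(3,4) Q(3,4)
    by (cases "x \<in> U"; cases "y \<in> U") simp_all
qed

text \<open>Translates extended types into relations. Adjoining x and y to their representations
  raises each size by 1 and leaves the intersection unchanged, so type 5-5-(m) becomes two relations
  of size 6 meeting in m points.\<close>

lemma basis_reps_relations:
  assumes B: "is_aff_basis B C" and xy: "C - B = {x, y}" "x \<noteq> y"
  obtains P Q where
    "P \<subseteq> C" "even_relation P" "x \<in> P" "y \<notin> P"
    "Q \<subseteq> C" "even_relation Q" "y \<in> Q" "x \<notin> Q"
    "card P = card (basis_rep B x) + 1" "card Q = card (basis_rep B y) + 1"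
    "P \<inter> Q = basis_rep B x \<inter> basis_rep B y"
proof -
  have ind: "aff_independent B" and sub: "B \<subseteq> C" and aff: "aff B = aff C"
    using B by (auto simp: is_aff_basis_def)
  have x: "x \<in> aff B" "x \<notin> B" "x \<in> C" and y: "y \<in> aff B" "y \<notin> B" "y \<in> C"
    using xy aff subset_aff[of C] by auto
  note reps = basis_rep_props(1)[OF ind x(1)] basis_rep_props(1)[OF ind y(1)]
  have notin: "x \<notin> basis_rep B x" "y \<notin> basis_rep B y" "x \<notin> basis_rep B y" "y \<notin> basis_rep B x"
    using reps x y by auto
  show thesis
    by (rule that[of "insert x (basis_rep B x)" "insert y (basis_rep B y)"])
       (use reps x y sub notin xy(2) even_relation_basis_rep[OF ind] in auto)
qed

section \<open>The two directions of the equivalence\<close>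

lemma extended_type_imp_cap:
  assumes B: "is_aff_basis B C" and "has_extended_type C B 5 5 m" "m \<in> {2, 3}"
  shows "is_cap C"
proof -
  obtain x y where xy: "C - B = {x, y}" "x \<noteq> y" and
    type: "card (basis_rep B x) = 5" "card (basis_rep B y) = 5"
      "card (basis_rep B x \<inter> basis_rep B y) = m"
    using assms(2) unfolding has_extended_type_def by blast
  obtain P Q where PQ: "P \<subseteq> C" "even_relation P" "x \<in> P" "y \<notin> P"
    "Q \<subseteq> C" "even_relation Q" "y \<in> Q" "x \<notin> Q" and
    card: "card P = 6" "card Q = 6" "card (P \<inter> Q) = m"
    by (rule basis_reps_relations[OF B xy]) (simp add: type)
  \<comment> \<open>The size is 6 + 6 - 2m, that is 8 or 6.\<close>
  have cardR: "card (sym_diff P Q) \<noteq> 4"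
    using card_sym_diff[of P Q] card assms(3) by auto
  have ind: "aff_independent B"
    using B by (simp add: is_aff_basis_def)
  show ?thesis
    unfolding is_cap_def
  proof
    assume "\<exists>U \<subseteq> C. is_quad U"
    then obtain U where U: "U \<subseteq> C" "card U = 4" "\<Sum>U = 0"
      by (auto simp: is_quad_def)
    then have "even_relation U"
      by (simp add: even_relation_def)
    then have "U \<in> {{}, P, Q, sym_diff P Q}"
      by (rule even_relations_codimension_2[OF ind xy(1) PQ U(1)])
    then show False
      using card cardR U(2) by auto
  qed
qed

lemma relations_imp_extended_type:
  assumes P: "P \<subseteq> C" "even_relation P" "card P = 6"
    and Q: "Q \<subseteq> C" "even_relation Q" "card Q = 6"
    and card: "card (P \<inter> Q) = m" "m \<in> {2, 3}"
    and all: "\<And>U. U \<subseteq> C \<Longrightarrow> even_relation U \<Longrightarrow> U \<in> {{}, P, Q, sym_diff P Q}"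
  shows "\<exists>B. is_aff_basis B C \<and> has_extended_type C B 5 5 m"
proof -
  \<comment> \<open>An inclusion would make the intersection have 6 points, but it has at most
    3.\<close>
  have "\<not> P \<subseteq> Q" "\<not> Q \<subseteq> P"
    using P(3) Q(3) card by (auto simp: Int_absorb1 Int_absorb2)
  then obtain x y where x: "x \<in> P" "x \<notin> Q" and y: "y \<in> Q" "y \<notin> P"
    by blast
  define B where "B = C - {x, y}"
  have sub: "P - {x} \<subseteq> B" "Q - {y} \<subseteq> B"
    using P(1) Q(1) x y by (auto simp: B_def)
  have CB: "C - B = {x, y}" "x \<noteq> y"
    using x y P Q by (auto simp: B_def)
  \<comment> \<open>P contains x, Q contains y and their symmetric difference contains both, so no
    nonempty relation avoids both removed points.\<close>
  have ind: "aff_independent B"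
    unfolding aff_independent_iff
  proof (intro allI impI)
    fix U assume U: "U \<subseteq> B" "even_relation U"
    then have "U \<in> {{}, P, Q, sym_diff P Q}"
      by (intro all) (auto simp: B_def)
    moreover have "x \<notin> U" "y \<notin> U"
      using U by (auto simp: B_def)
    ultimately show "U = {}"
      using x y by blast
  qed
  note Px = even_relation_remove[OF P(2) x(1)] and Qy = even_relation_remove[OF Q(2) y(1)]
  have "x \<in> aff B"
    using sub(1) Px unfolding aff_def by (intro CollectI exI[of _ "P - {x}"]) simp
  moreover have "y \<in> aff B"
    using sub(2) Qy unfolding aff_def by (intro CollectI exI[of _ "Q - {y}"]) simp
  ultimately have "C \<subseteq> aff B"
    using subset_aff[of B] by (auto simp: B_def)
  then have basis: "is_aff_basis B C"
    using ind aff_eqI[of B C] by (auto simp: is_aff_basis_def B_def)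
  have reps: "basis_rep B x = P - {x}" "basis_rep B y = Q - {y}"
    using basis_rep_eqI[OF ind sub(1) Px] basis_rep_eqI[OF ind sub(2) Qy] by auto
  moreover have "(P - {x}) \<inter> (Q - {y}) = P \<inter> Q"
    using x y by auto
  ultimately have "has_extended_type C B 5 5 m"
    unfolding has_extended_type_def using CB P Q card x y
    by (intro exI[of _ x] exI[of _ y]) simp
  with basis show ?thesis by blast
qed

lemma cap_imp_extended_type:
  assumes card: "card C = 10" and dim: "aff_dimension C = 7" and cap: "is_cap C"
  shows "\<exists>B. is_aff_basis B C \<and> (has_extended_type C B 5 5 2 \<or> has_extended_type C B 5 5 3)"
proof -
  obtain B where B: "is_aff_basis B C"
    using aff_basis_exists by blast
  then have ind: "aff_independent B" and sub: "B \<subseteq> C"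
    by (auto simp: is_aff_basis_def)
  have "card B = 8"
    using aff_dimension_eq_card_basis[OF B] card dim by force
  then have "card (C - B) = 2"
    using card sub by (simp add: card_Diff_subset)
  then obtain x y where xy: "C - B = {x, y}" "x \<noteq> y"
    by (auto simp: card_2_iff)
  obtain P Q where PQ: "P \<subseteq> C" "even_relation P" "x \<in> P" "y \<notin> P"
    "Q \<subseteq> C" "even_relation Q" "y \<in> Q" "x \<notin> Q"
    using basis_reps_relations[OF B xy] by metis
  define R where "R = sym_diff P Q"
  have R: "R \<subseteq> C" "even_relation R" "x \<in> R"
    using PQ even_relation_sym_diff by (auto simp: R_def)
  have all: "U \<in> {{}, P, Q, R}" if "U \<subseteq> C" "even_relation U" for U
    using even_relations_codimension_2[OF ind xy(1) PQ that] by (simp add: R_def)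
  have ge6: "card U \<ge> 6 \<and> even (card U)" if "U \<subseteq> C" "even_relation U" "U \<noteq> {}" for U
  proof -
    have "card U \<noteq> 4"
      using cap that by (auto simp: is_cap_def is_quad_def even_relation_def)
    moreover have "even (card U)"
      using that by (simp add: even_relation_def)
    ultimately show ?thesis
      using even_relation_card_ge_4[OF that(2,3)] by presburger
  qed
  have ge: "card P \<ge> 6 \<and> even (card P)" "card Q \<ge> 6 \<and> even (card Q)" "card R \<ge> 6 \<and> even (card R)"
    using ge6 PQ R by blast+
  \<comment> \<open>Three even numbers, each at least 6, exceed 18 in total by at most 2, so at most
    one of them is 8 and the others are 6.\<close>
  have arith: "(p = 6 \<and> q = 6 \<or> p = 6 \<and> r = 6 \<or> q = 6 \<and> r = 6) \<and> p \<le> 8 \<and> q \<le> 8 \<and> r \<le> 8"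
    if "p + q + r \<le> 20" "p \<ge> 6 \<and> even p" "q \<ge> 6 \<and> even q" "r \<ge> 6 \<and> even r" for p q r :: nat
    using that by (elim conjE evenE) (simp, arith)
  have "card (P \<union> Q) \<le> 10"
    using card PQ card_mono[of C "P \<union> Q"] by simp
  moreover have "card (P \<union> Q) + card (P \<inter> Q) = card P + card Q"
    using card_Un_Int[of P Q] by simp
  ultimately have "card P + card Q + card R \<le> 20"
    using card_sym_diff[of P Q] unfolding R_def by simp
  from arith[OF this ge] have two: "card P = 6 \<and> card Q = 6 \<or> card P = 6 \<and> card R = 6 \<or> card Q = 6 \<and> card R = 6"
    and le8: "card P \<le> 8" "card Q \<le> 8" "card R \<le> 8"
    by auto
  \<comment> \<open>Each of P, Q, R is the symmetric difference of the other two, so any two of size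
    6 can serve as U and V. Then \<open>card W\<close> = 12 - 2 \<open>card (U \<inter> V)\<close>,
    so \<open>card W\<close> = 8 gives intersection size 2 and \<open>card W\<close> = 6 gives
    3.\<close>
  have key: ?thesis
    if "U \<subseteq> C" "even_relation U" "card U = 6" "V \<subseteq> C" "even_relation V" "card V = 6"
      and W: "sym_diff U V = W" "W \<subseteq> C" "even_relation W" "card W \<le> 8" "W \<noteq> {}" "{U, V, W} = {P, Q, R}"
    for U V W
  proof -
    have "card W \<ge> 6 \<and> even (card W)"
      using ge6[OF W(2,3,5)] .
    then have "card W = 6 \<or> card W = 8"
      using W(4) by presburger
    then have "card (U \<inter> V) \<in> {2, 3}"
      using card_sym_diff[of U V] that(3,6) W(1) by auto
    moreover have "\<And>S. S \<subseteq> C \<Longrightarrow> even_relation S \<Longrightarrow> S \<in> {{}, U, V, sym_diff U V}"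
      using all W(1,6) by simp
    ultimately show ?thesis
      using relations_imp_extended_type[OF that(1-6) refl] by fastforce
  qed
  have "sym_diff P R = Q" "sym_diff Q R = P"
    by (auto simp: R_def)
  moreover have "{P, R, Q} = {P, Q, R}" "{Q, R, P} = {P, Q, R}"
    by auto
  moreover have "P \<noteq> {}" "Q \<noteq> {}" "R \<noteq> {}"
    using PQ R by auto
  ultimately show ?thesis
    using two key[of P Q R, OF _ _ _ _ _ _ R_def[symmetric]] key[of P R Q] key[of Q R P]
      PQ(1,2,5,6) R(1,2) le8
    by argo
qed

theorem theorem5p4:
  fixes C :: "('n::finite) Z2vec set"
  assumes "card C = 10" and "aff_dimension C = 7"
  shows "is_cap C \<longleftrightarrow>
    (\<exists>B. is_aff_basis B C \<and>
       (has_extended_type C B 5 5 2 \<or> has_extended_type C B 5 5 3))"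
  using cap_imp_extended_type[OF assms] extended_type_imp_cap by blast

end
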